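(* Let $u_n$ denote the maximum number of inversions achieved by a member of $\mathcal{R}_n$, i.e., $u_n=\max_{\pi\in\mathcal{R}_n}\mathrm{inv}(\pi)=\deg(A_n(q,1))$. Let $n=\binom{k}{2}+d$ for some $k\geq 2$ and $0\leq d\leq k-1$. Then $$u_n=\binom{k}{3}+3\binom{k}{4}+d\binom{k-1}{2}+\binom{d}{2},$$ with this value being achieved by exactly $\binom{k-1}{d}+\binom{k-2}{d-2}$ members of $\mathcal{R}_n$.
   Context: Permutations $\pi=\pi_1\cdots\pi_n$ of $[n]=\{1,\ldots,n\}$ are written in one-line notation. $\mathrm{inv}(\pi)$ is the number of pairs $(i,j)$ with $1\le i<j\le n$ and $\pi_i>\pi_j$. A run of $\pi$ is a maximal increasing sequence of consecutive entries. A permutation is run-sorted if $\pi_1=1$ and the first entries of its runs, read from left to right, form an increasing sequence. $\mathcal{R}_n$ denotes the set of run-sorted permutations of $[n]$, and $A_n(q,1)=\sum_{\pi\in\mathcal{R}_n}q^{\mathrm{inv}(\pi)}$. Binomial coefficients $\binom{a}{b}$ are $0$ unless $0\le b\le a$. *)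

theory Defs
  imports
    "HOL-Combinatorics.Multiset_Permutations"
    "HOL-Computational_Algebra.Polynomial"
begin

text \<open>
  A permutation of \<open>{1..n}\<close> in one-line notation is a list in \<open>permutations_of_set {1..n}\<close>.
  List positions are counted from \<open>0\<close>, so \<open>\<pi> ! i\<close> is the entry \<open>\<pi>\<close> with subscript \<open>i + 1\<close>.
\<close>

definition inversions :: "nat list \<Rightarrow> nat" where
  "inversions \<pi> = card {(i, j). i < j \<and> j < length \<pi> \<and> \<pi> ! i > \<pi> ! j}"

text \<open>The nonempty block of consecutive positions \<open>i, \<dots>, j - 1\<close> (\<open>j\<close> excluded).\<close>

definition increasing_block :: "nat list \<Rightarrow> nat \<Rightarrow> nat \<Rightarrow> bool" where
  "increasing_block \<pi> i j \<longleftrightarrow>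
     i < j \<and> j \<le> length \<pi> \<and> (\<forall>a b. i \<le> a \<and> a < b \<and> b < j \<longrightarrow> \<pi> ! a < \<pi> ! b)"

definition is_run :: "nat list \<Rightarrow> nat \<Rightarrow> nat \<Rightarrow> bool" where
  "is_run \<pi> i j \<longleftrightarrow>
     increasing_block \<pi> i j \<and>
     (\<forall>i' j'. i' \<le> i \<and> j \<le> j' \<and> increasing_block \<pi> i' j' \<longrightarrow> i' = i \<and> j' = j)"

definition run_sorted :: "nat list \<Rightarrow> bool" where
  "run_sorted \<pi> \<longleftrightarrow>
     \<pi> \<noteq> [] \<and> hd \<pi> = 1 \<and>
     (\<forall>i j i' j'. is_run \<pi> i j \<and> is_run \<pi> i' j' \<and> i < i' \<longrightarrow> \<pi> ! i < \<pi> ! i')"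

definition run_sorted_perms :: "nat \<Rightarrow> nat list set" where
  "run_sorted_perms n = {\<pi> \<in> permutations_of_set {1..n}. run_sorted \<pi>}"

text \<open>This is \<open>A\<^sub>n(q,1)\<close>, as a polynomial in \<open>q\<close>.\<close>

definition inv_poly :: "nat \<Rightarrow> int poly" where
  "inv_poly n = (\<Sum>\<pi>\<in>run_sorted_perms n. monom 1 (inversions \<pi>))"

definition max_inv :: "nat \<Rightarrow> nat" where
  "max_inv n = Max (inversions ` run_sorted_perms n)"

end

theory Submission
  imports Defs
begin

text \<open>
  The idea is to count the pairs of positions that cannot be inversions and to read this count off
  the run lengths.  Number the runs and the offsets inside each run from \<open>0\<close>.  The entry at offset
  \<open>t\<close> of run \<open>j\<close> is preceded by at least \<open>j + t\<close> smaller entries: the \<open>t\<close> earlier entries of its own run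
  and the starts of the \<open>j\<close> earlier runs.  So a run-sorted permutation of \<open>{1..n}\<close> has at most
  \<open>(n choose 2) - w\<close> inversions, where \<open>w\<close> is the sum of \<open>j + t\<close> over all entries
  (\<open>inversions_plus_waste_le\<close>).  Equality forces every non-start entry of a run to exceed all
  entries of later runs, and this leaves exactly one permutation for every list of
  run lengths (\<open>inversions_plus_waste_eq_imp_extremal\<close>, \<open>extremal_properties\<close>).  The lists of run
  lengths that occur are those in which every run but the last has length at least \<open>2\<close>, because a run
  of length \<open>1\<close> followed by a larger start would not end there.

  It remains to minimise \<open>w\<close> over run-length lists with sum \<open>n\<close>.  Think of the pairs \<open>(j, t)\<close> as cells;
  \<open>c + 1\<close> cells have weight \<open>c = j + t\<close>, and with \<open>n = (k choose 2) + d\<close> the cheapest choice is all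
  cells of weight below \<open>k - 1\<close> together with \<open>d\<close> of the \<open>k\<close> cells of weight \<open>k - 1\<close>.  Equivalently, run
  \<open>j\<close> has length \<open>k - 1 - j\<close> or \<open>k - j\<close>, and the larger value is taken \<open>d\<close> times
  (\<open>waste_lower_bound\<close>, \<open>tight_Suc_Cons\<close>).  If the last of these \<open>k\<close> cells, \<open>(k - 1, 0)\<close>, is not used,
  the \<open>d\<close> cells may be chosen freely among the other \<open>k - 1\<close>.  If it is used, then run \<open>k - 2\<close> is no longer the
  last one and needs length \<open>2\<close>, which fixes a second cell and leaves \<open>d - 2\<close> to be chosen among
  \<open>k - 2\<close>.  The two cases give the two binomial coefficients (\<open>card_staircases\<close>).
\<close>

section \<open>Inversions of a list\<close>

lemma inversions_Nil [simp]: "inversions [] = 0"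
  by (simp add: inversions_def)

lemma inversions_Cons:
  "inversions (x # xs) = length (filter (\<lambda>y. y < x) xs) + inversions xs"
proof -
  let ?A = "{j. j < length xs \<and> xs ! j < x}"
  let ?B = "{(i, j). i < j \<and> j < length xs \<and> xs ! i > xs ! j}"
  have fin: "finite ?B"
    by (rule finite_subset[of _ "{..<length xs} \<times> {..<length xs}"]) auto
  have eq: "{(i, j). i < j \<and> j < length (x # xs) \<and> (x # xs) ! i > (x # xs) ! j}
      = (\<lambda>j. (0, Suc j)) ` ?A \<union> map_prod Suc Suc ` ?B" (is "?L = ?R")
  proof (rule set_eqI)
    fix p :: "nat \<times> nat"
    obtain i j where p: "p = (i, j)" by (cases p)
    show "p \<in> ?L \<longleftrightarrow> p \<in> ?R"
      unfolding p by (cases i; cases j) (auto simp: image_iff)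
  qed
  have "card ?R = card ((\<lambda>j. (0::nat, Suc j)) ` ?A) + card (map_prod Suc Suc ` ?B)"
    using fin by (intro card_Un_disjoint) auto
  also have "\<dots> = card ?A + card ?B"
    by (simp add: card_image inj_on_def map_prod_def split: prod.splits)
  finally show ?thesis
    unfolding inversions_def eq by (simp add: length_filter_conv_card)
qed

lemma inversions_append_sorted:
  assumes "sorted_wrt (<) xs"
  shows "inversions (xs @ ys) = (\<Sum>x\<leftarrow>xs. length (filter (\<lambda>y. y < x) ys)) + inversions ys"
  using assms
proof (induction xs)
  case (Cons x xs)
  then have "filter (\<lambda>y. y < x) xs = []" by (auto simp: filter_empty_conv)
  with Cons show ?case by (simp add: inversions_Cons)
qed simp

section \<open>Run-sorted lists and their run lengths\<close>

definition run_start :: "nat list \<Rightarrow> nat \<Rightarrow> bool" where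
  "run_start \<pi> i \<longleftrightarrow> i < length \<pi> \<and> (i = 0 \<or> \<not> \<pi> ! (i - 1) < \<pi> ! i)"

text \<open>
  A run is a block that is maximal under inclusion.  From a position where a run starts, the longest
  increasing block cannot be extended to the left, since that would need an ascent into the start.
\<close>

lemma run_start_iff_is_run: "run_start \<pi> i \<longleftrightarrow> (\<exists>j. is_run \<pi> i j)"
proof
  assume st: "run_start \<pi> i"
  let ?P = "\<lambda>j. increasing_block \<pi> i j"
  have P0: "?P (Suc i)"
    using st by (auto simp: run_start_def increasing_block_def)
  have bd: "\<And>j. ?P j \<Longrightarrow> j \<le> length \<pi>" by (simp add: increasing_block_def)
  define j where "j = (GREATEST j. ?P j)"
  have Pj: "?P j" unfolding j_def by (rule GreatestI_nat[where b = "length \<pi>"]) (use P0 bd in auto)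
  have "is_run \<pi> i j"
    unfolding is_run_def
  proof (intro conjI allI impI)
    show "?P j" by (rule Pj)
    fix i' j' assume h: "i' \<le> i \<and> j \<le> j' \<and> increasing_block \<pi> i' j'"
    show "i' = i"
    proof (rule ccontr)
      assume "i' \<noteq> i"
      then have lt: "i' \<le> i - 1" "i - 1 < i" using h by auto
      have "i < j" using Pj by (simp add: increasing_block_def)
      then have "i < j'" using h by simp
      then have "\<pi> ! (i - 1) < \<pi> ! i"
        using h lt unfolding increasing_block_def by blast
      then show False using st lt by (auto simp: run_start_def)
    qed
    then have "?P j'" using h by simp
    then have "j' \<le> j" unfolding j_def by (rule Greatest_le_nat[where b = "length \<pi>"]) (use bd in auto)
    then show "j' = j" using h by simp
  qed
  then show "\<exists>j. is_run \<pi> i j" ..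
next
  assume "\<exists>j. is_run \<pi> i j"
  then obtain j where j: "is_run \<pi> i j" ..
  then have inc: "increasing_block \<pi> i j" by (simp add: is_run_def)
  show "run_start \<pi> i"
  proof (rule ccontr)
    assume "\<not> run_start \<pi> i"
    then have i: "i > 0" "\<pi> ! (i - 1) < \<pi> ! i"
      using inc by (auto simp: run_start_def increasing_block_def)
    have "increasing_block \<pi> (i - 1) j"
      unfolding increasing_block_def
    proof (intro conjI allI impI)
      show "i - 1 < j" "j \<le> length \<pi>" using inc by (auto simp: increasing_block_def)
      fix a b assume ab: "i - 1 \<le> a \<and> a < b \<and> b < j"
      have base: "\<pi> ! c < \<pi> ! e" if "i \<le> c" "c < e" "e < j" for c e
        using inc that by (simp add: increasing_block_def)
      show "\<pi> ! a < \<pi> ! b"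
      proof (cases "a = i - 1")
        case True
        show ?thesis
        proof (cases "b = i")
          case False
          then have "\<pi> ! i < \<pi> ! b" using base ab i True by auto
          with i True show ?thesis by simp
        qed (use i True in simp)
      qed (use base ab in auto)
    qed
    then have "i - 1 = i" using j unfolding is_run_def by (meson diff_le_self le_refl)
    then show False using i by simp
  qed
qed

definition starts_increase :: "nat list \<Rightarrow> bool" where
  "starts_increase \<pi> \<longleftrightarrow> (\<forall>i j. run_start \<pi> i \<and> run_start \<pi> j \<and> i < j \<longrightarrow> \<pi> ! i < \<pi> ! j)"

lemma run_sorted_iff:
  "run_sorted \<pi> \<longleftrightarrow> \<pi> \<noteq> [] \<and> hd \<pi> = 1 \<and> starts_increase \<pi>"
  unfolding run_sorted_def starts_increase_def run_start_iff_is_run by blast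

text \<open>
  \<open>sorted_runs ms \<pi>\<close> peels off the first run \<open>x # ys\<close> of \<open>\<pi>\<close> and records the run lengths in \<open>ms\<close>.
  Comparing \<open>x\<close> with the start of the next run only is enough for all starts to increase, and
  \<open>hd \<pi> < last (x # ys)\<close> says that the run cannot be continued.
\<close>

inductive sorted_runs :: "nat list \<Rightarrow> nat list \<Rightarrow> bool" where
  Nil: "sorted_runs [] []"
| Cons: "sorted_runs (Suc (length ys) # ms) (x # ys @ \<pi>)"
  if "sorted_runs ms \<pi>" "sorted_wrt (<) (x # ys)"
     "\<pi> = [] \<or> x < hd \<pi> \<and> hd \<pi> < last (x # ys)"

lemma sum_list_sorted_runs: "sorted_runs ms \<pi> \<Longrightarrow> sum_list ms = length \<pi>"
  by (induction rule: sorted_runs.induct) auto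

lemma sorted_runs_hd_le: "sorted_runs ms \<pi> \<Longrightarrow> y \<in> set \<pi> \<Longrightarrow> hd \<pi> \<le> y"
proof (induction rule: sorted_runs.induct)
  case (Cons ms \<pi> x ys)
  then show ?case by (cases "\<pi> = []") (auto simp: less_imp_le intro: less_imp_le order_trans)
qed simp

lemma run_start_append:
  assumes "xs \<noteq> []" "sorted_wrt (<) xs" "\<pi> = [] \<or> \<not> last xs < hd \<pi>"
  shows "run_start (xs @ \<pi>) i \<longleftrightarrow> i = 0 \<or> (length xs \<le> i \<and> run_start \<pi> (i - length xs))"
proof (cases "i < length xs")
  case True
  then have "xs ! (i - 1) < xs ! i" if "i \<noteq> 0"
    using assms(2) that by (intro sorted_wrt_nth_less) auto
  then show ?thesis
    using True by (auto simp: run_start_def nth_append)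
next
  case False
  show ?thesis
  proof (cases "i = length xs")
    case True
    then show ?thesis
      using assms by (cases "\<pi> = []") (auto simp: run_start_def nth_append last_conv_nth hd_conv_nth)
  next
    case ne: False
    then have "\<not> i - 1 < length xs" "i - 1 - length xs = i - length xs - 1" using False by auto
    then show ?thesis
      using False ne assms by (auto simp: run_start_def nth_append)
  qed
qed

lemma first_run_decomposition:
  "\<pi> \<noteq> [] \<Longrightarrow> \<exists>x ys zs. \<pi> = x # ys @ zs \<and> sorted_wrt (<) (x # ys)
      \<and> (zs = [] \<or> \<not> last (x # ys) < (hd zs :: nat))"
proof (induction \<pi>)
  case (Cons a \<pi>)
  show ?case
  proof (cases "\<pi> = []")
    case True
    then show ?thesis by (intro exI[of _ a] exI[of _ "[]"]) auto
  next
    case False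
    with Cons obtain x ys zs where *: "\<pi> = x # ys @ zs" "sorted_wrt (<) (x # ys)"
      "zs = [] \<or> \<not> last (x # ys) < hd zs" by blast
    show ?thesis
    proof (cases "a < x")
      case True
      then show ?thesis
        using * by (intro exI[of _ a] exI[of _ "x # ys"] exI[of _ zs]) auto
    next
      case False
      then show ?thesis
        using * by (intro exI[of _ a] exI[of _ "[]"] exI[of _ \<pi>]) auto
    qed
  qed
qed simp

lemma starts_increase_append:
  assumes "sorted_wrt (<) (x # ys)" "\<pi> = [] \<or> \<not> last (x # ys) < hd \<pi>"
  shows "starts_increase (x # ys @ \<pi>)
    \<longleftrightarrow> starts_increase \<pi> \<and> (\<forall>i. run_start \<pi> i \<longrightarrow> x < \<pi> ! i)"
proof -
  let ?l = "length (x # ys)"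
  have st: "run_start ((x # ys) @ \<pi>) i \<longleftrightarrow> i = 0 \<or> (?l \<le> i \<and> run_start \<pi> (i - ?l))" for i
    using assms by (intro run_start_append) auto
  have nth: "((x # ys) @ \<pi>) ! (i + ?l) = \<pi> ! i" "((x # ys) @ \<pi>) ! 0 = x" for i
    by (simp_all add: nth_append)
  have st1: "run_start ((x # ys) @ \<pi>) (i + ?l) \<longleftrightarrow> run_start \<pi> i" for i
    unfolding st by auto
  have st0: "run_start ((x # ys) @ \<pi>) 0" unfolding st by simp
  have "starts_increase ((x # ys) @ \<pi>)
    \<longleftrightarrow> starts_increase \<pi> \<and> (\<forall>i. run_start \<pi> i \<longrightarrow> x < \<pi> ! i)" (is "?L \<longleftrightarrow> ?R")
  proof
    assume L: ?L
    have "\<pi> ! i < \<pi> ! j" if "run_start \<pi> i" "run_start \<pi> j" "i < j" for i j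
      using L that st1[of i] st1[of j] nth(1)[of i] nth(1)[of j] unfolding starts_increase_def
      by (metis add_less_cancel_right)
    moreover have "x < \<pi> ! i" if "run_start \<pi> i" for i
      using L that st1[of i] st0 nth(1)[of i] nth(2) unfolding starts_increase_def
      by (metis add_gr_0 length_greater_0_conv list.distinct(1))
    ultimately show ?R unfolding starts_increase_def by blast
  next
    assume R: ?R
    show ?L
      unfolding starts_increase_def
    proof (intro allI impI)
      fix i j
      assume h: "run_start ((x # ys) @ \<pi>) i \<and> run_start ((x # ys) @ \<pi>) j \<and> i < j"
      then have "j \<noteq> 0" by simp
      then have j: "?l \<le> j" "run_start \<pi> (j - ?l)" using h st[of j] by auto
      then have vj: "((x # ys) @ \<pi>) ! j = \<pi> ! (j - ?l)" using nth(1)[of "j - ?l"] by simp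
      show "((x # ys) @ \<pi>) ! i < ((x # ys) @ \<pi>) ! j"
      proof (cases "i = 0")
        case True
        then show ?thesis unfolding vj using R j by simp
      next
        case False
        then have i: "?l \<le> i" "run_start \<pi> (i - ?l)" using h st[of i] by auto
        then have vi: "((x # ys) @ \<pi>) ! i = \<pi> ! (i - ?l)" using nth(1)[of "i - ?l"] by simp
        have "i - ?l < j - ?l" using i j h by linarith
        then show ?thesis unfolding vi vj using R i j unfolding starts_increase_def by blast
      qed
    qed
  qed
  then show ?thesis by simp
qed

text \<open>
  The positional definition of run-sortedness agrees with the recursive one, which is the form in
  which everything below is proved by induction over the runs.  Distinctness turns the
  non-ascent at the end of a run into the strict descent of \<open>sorted_runs\<close>.
\<close>

lemma starts_increase_iff_sorted_runs:
  assumes "distinct \<pi>"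
  shows "starts_increase \<pi> \<longleftrightarrow> (\<exists>ms. sorted_runs ms \<pi>)"
proof
  show "\<exists>ms. sorted_runs ms \<pi>" if "starts_increase \<pi>"
    using that assms
  proof (induction \<pi> rule: length_induct)
    case (1 \<pi>)
    show ?case
    proof (cases "\<pi> = []")
      case True
      then show ?thesis by (auto intro: sorted_runs.Nil)
    next
      case False
      then obtain x ys zs where *: "\<pi> = x # ys @ zs" "sorted_wrt (<) (x # ys)"
        "zs = [] \<or> \<not> last (x # ys) < hd zs" using first_run_decomposition by blast
      then have s: "starts_increase zs" "\<And>i. run_start zs i \<Longrightarrow> x < zs ! i"
        using 1(2) starts_increase_append[of x ys zs] by auto
      have "\<exists>ms. sorted_runs ms zs"
        using 1(1,3) s(1) by (auto simp: *(1))
      then obtain ms where ms: "sorted_runs ms zs" ..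
      have "x < hd zs \<and> hd zs < last (x # ys)" if "zs \<noteq> []"
      proof
        have "run_start zs 0" using that by (simp add: run_start_def)
        then show "x < hd zs" using s(2) that by (simp add: hd_conv_nth)
        have "last (x # ys) \<in> set (x # ys)" by (rule last_in_set) simp
        moreover have "hd zs \<in> set zs" using that by simp
        ultimately have "last (x # ys) \<noteq> hd zs" using 1(3) by (auto simp: *(1) simp del: last.simps)
        then show "hd zs < last (x # ys)" using *(3) that by simp
      qed
      then have "sorted_runs (Suc (length ys) # ms) \<pi>"
        unfolding *(1) using ms *(2) by (intro sorted_runs.Cons) auto
      then show ?thesis ..
    qed
  qed
  show "starts_increase \<pi>" if "\<exists>ms. sorted_runs ms \<pi>"
  proof -
    from that obtain ms where "sorted_runs ms \<pi>" ..
    then show ?thesis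
    proof (induction rule: sorted_runs.induct)
      case Nil
      then show ?case by (simp add: starts_increase_def run_start_def)
    next
      case (Cons ms \<pi> x ys)
      have "x < \<pi> ! i" if "run_start \<pi> i" for i
      proof -
        have "i < length \<pi>" using that by (simp add: run_start_def)
        then have "hd \<pi> \<le> \<pi> ! i" "\<pi> \<noteq> []" using sorted_runs_hd_le[OF Cons(1)] by auto
        then show ?thesis using Cons(3) by auto
      qed
      then show ?case using Cons by (subst starts_increase_append) auto
    qed
  qed
qed

fun admissible :: "nat list \<Rightarrow> bool" where
  "admissible [] \<longleftrightarrow> True"
| "admissible (m # ms) \<longleftrightarrow> m \<ge> 1 \<and> (ms \<noteq> [] \<longrightarrow> m \<ge> 2) \<and> admissible ms"

text \<open>
  If another run follows, its start lies strictly between the first and the last entry of the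
  current run, so these two entries differ.
\<close>

lemma sorted_runs_admissible: "sorted_runs ms \<pi> \<Longrightarrow> admissible ms"
proof (induction rule: sorted_runs.induct)
  case (Cons ms \<pi> x ys)
  have "ms = []" if "\<pi> = []" using Cons(1) that by (auto elim: sorted_runs.cases)
  then show ?case using Cons by (cases ys) auto
qed simp

section \<open>Unavoidable non-inversions\<close>

text \<open>
  \<open>waste ms\<close> is the sum of \<open>j + t\<close> over all entries, where an entry has offset \<open>t\<close> in run \<open>j\<close>.  In the
  recursion, \<open>m choose 2\<close> is the sum of the offsets in the first run, and \<open>sum_list ms\<close> accounts for the
  index of every later run growing by \<open>1\<close>.
\<close>

fun waste :: "nat list \<Rightarrow> nat" where
  "waste [] = 0"
| "waste (m # ms) = (m choose 2) + sum_list ms + waste ms"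

text \<open>
  For admissible \<open>ms\<close>, the list on \<open>{a..<a + sum_list ms}\<close> with run lengths \<open>ms\<close> and as many inversions
  as possible: the run starts are the smallest values, in increasing order, and the remaining
  values are dealt out from the top, so that the first run receives the largest ones.
\<close>

fun extremal :: "nat \<Rightarrow> nat list \<Rightarrow> nat list" where
  "extremal a [] = []"
| "extremal a (m # ms) =
     a # [a + sum_list ms + 1 ..< a + sum_list ms + m] @ extremal (Suc a) ms"

lemma choose_two_add: "(a + b) choose 2 = (a choose 2) + (b choose 2) + a * (b::nat)"
  by (induction a) (simp_all add: numeral_2_eq_2)

text \<open>
  The start \<open>x\<close> is smaller than everything after it, so only the entries of \<open>ys\<close> can form inversions
  with the later entries \<open>\<pi>\<close>.
\<close>

lemma inversions_first_run:
  assumes "sorted_wrt (<) (x # ys)" "\<And>p. p \<in> set \<pi> \<Longrightarrow> x < p"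
  shows "inversions (x # ys @ \<pi>) \<le> length ys * length \<pi> + inversions \<pi>"
    and "inversions (x # ys @ \<pi>) = length ys * length \<pi> + inversions \<pi>
      \<longleftrightarrow> (\<forall>y\<in>set ys. \<forall>p\<in>set \<pi>. p < y)"
proof -
  let ?f = "\<lambda>y. length (filter (\<lambda>p. p < y) \<pi>)"
  have "filter (\<lambda>p. p < x) \<pi> = []" using assms(2) by (fastforce simp: filter_empty_conv)
  then have inv: "inversions (x # ys @ \<pi>) = (\<Sum>y\<leftarrow>ys. ?f y) + inversions \<pi>"
    using inversions_append_sorted[OF assms(1), of \<pi>] by simp
  have *: "(\<Sum>y\<leftarrow>ys. ?f y) \<le> length ys * length \<pi> \<and>
    ((\<Sum>y\<leftarrow>ys. ?f y) = length ys * length \<pi> \<longleftrightarrow> (\<forall>y\<in>set ys. \<forall>p\<in>set \<pi>. p < y))"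
  proof (induction ys)
    case (Cons y ys)
    have le: "?f y \<le> length \<pi>" by simp
    have "?f y = length \<pi> \<longleftrightarrow> (\<forall>p\<in>set \<pi>. p < y)"
      by (metis filter_True length_filter_less nless_le)
    moreover have "?f y + (\<Sum>y\<leftarrow>ys. ?f y) = length \<pi> + length ys * length \<pi> \<longleftrightarrow>
      ?f y = length \<pi> \<and> (\<Sum>y\<leftarrow>ys. ?f y) = length ys * length \<pi>"
      using Cons le by linarith
    ultimately show ?case using Cons le by (simp add: add_mono)
  qed simp
  show "inversions (x # ys @ \<pi>) \<le> length ys * length \<pi> + inversions \<pi>"
    "inversions (x # ys @ \<pi>) = length ys * length \<pi> + inversions \<pi>
      \<longleftrightarrow> (\<forall>y\<in>set ys. \<forall>p\<in>set \<pi>. p < y)"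
    unfolding inv using * by auto
qed

lemma inversions_plus_waste_le:
  "sorted_runs ms \<pi> \<Longrightarrow> inversions \<pi> + waste ms \<le> length \<pi> choose 2"
proof (induction rule: sorted_runs.induct)
  case (Cons ms \<pi> x ys)
  have "x < p" if "p \<in> set \<pi>" for p
    using sorted_runs_hd_le[OF Cons(1) that] Cons(3) that by auto
  then show ?case
    using inversions_first_run(1)[OF Cons(2), of \<pi>] Cons(4) sum_list_sorted_runs[OF Cons(1)]
      choose_two_add[of "Suc (length ys)" "length \<pi>"]
    by simp
qed simp

text \<open>
  Equality in \<open>inversions_plus_waste_le\<close> must hold at every run.  Hence all of \<open>ys\<close> lies above all of
  \<open>\<pi>\<close>, and as the values form an interval, \<open>x\<close> is its minimum, \<open>ys\<close> its topmost part and \<open>\<pi>\<close> fills the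
  interval in between.
\<close>

lemma inversions_plus_waste_eq_imp_extremal:
  assumes "sorted_runs ms \<pi>" "inversions \<pi> + waste ms = length \<pi> choose 2"
    "distinct \<pi>" "set \<pi> = {a..<a + length \<pi>}"
  shows "\<pi> = extremal a ms"
  using assms
proof (induction arbitrary: a rule: sorted_runs.induct)
  case (Cons ms \<pi> x ys)
  have min: "x < p" if "p \<in> set \<pi>" for p
    using sorted_runs_hd_le[OF Cons(1) that] Cons(3) that by auto
  note len = sum_list_sorted_runs[OF Cons(1)]
  have ub: "inversions \<pi> + waste ms \<le> length \<pi> choose 2"
    by (rule inversions_plus_waste_le[OF Cons(1)])
  note c2 = choose_two_add[of "Suc (length ys)" "length \<pi>"]
  note bd = inversions_first_run[OF Cons(2), of \<pi>, OF min]
  have eq1: "inversions \<pi> + waste ms = length \<pi> choose 2"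
    using bd(1) c2 Cons(5) len ub by simp
  have "inversions (x # ys @ \<pi>) = length ys * length \<pi> + inversions \<pi>"
    using c2 Cons(5) len eq1 by simp
  then have sep: "\<And>y p. y \<in> set ys \<Longrightarrow> p \<in> set \<pi> \<Longrightarrow> p < y" using bd(2) by blast
  have S: "insert x (set ys \<union> set \<pi>) = {a..<a + Suc (length ys + length \<pi>)}"
    using Cons(7) by simp
  have xa: "x = a"
  proof -
    have "a \<in> insert x (set ys \<union> set \<pi>)" unfolding S by simp
    moreover have "x \<in> {a..<a + Suc (length ys + length \<pi>)}" unfolding S[symmetric] by simp
    ultimately show ?thesis using min Cons(2) by (auto dest: leD)
  qed
  have S2: "set ys \<union> set \<pi> = {Suc a..<Suc a + (length \<pi> + length ys)}"
  proof -
    have "x \<notin> set ys \<union> set \<pi>" using Cons(6) by auto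
    then have "set ys \<union> set \<pi> = insert x (set ys \<union> set \<pi>) - {x}" by blast
    also have "\<dots> = {a..<a + Suc (length ys + length \<pi>)} - {a}" unfolding S unfolding xa ..
    also have "\<dots> = {Suc a..<Suc a + (length \<pi> + length ys)}" by auto
    finally show ?thesis .
  qed
  have lp: "card (set \<pi>) = length \<pi>"
    using Cons(6) by (auto simp: distinct_card)
  \<comment> \<open>As \<open>\<pi>\<close> lies below \<open>ys\<close>, it is an initial segment of the interval, so its size determines it.\<close>
  have Sp: "set \<pi> = {Suc a..<Suc a + length \<pi>}"
  proof (rule card_subset_eq)
    show "set \<pi> \<subseteq> {Suc a..<Suc a + length \<pi>}"
    proof
      fix p assume p: "p \<in> set \<pi>"
      have "{Suc a..p} \<subseteq> set \<pi>"
      proof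
        fix q assume q: "q \<in> {Suc a..p}"
        have "p \<in> {Suc a..<Suc a + (length \<pi> + length ys)}" unfolding S2[symmetric] using p by simp
        then have "q \<in> set ys \<union> set \<pi>" unfolding S2 using q by simp
        then show "q \<in> set \<pi>" using sep[OF _ p, of q] q by auto
      qed
      then have "card {Suc a..p} \<le> card (set \<pi>)" by (intro card_mono) auto
      then show "p \<in> {Suc a..<Suc a + length \<pi>}" using lp min[OF p] xa by auto
    qed
  qed (simp_all add: lp)
  have Sy: "set ys = {Suc a + length \<pi>..<Suc a + (length \<pi> + length ys)}"
  proof -
    have "set ys \<inter> set \<pi> = {}" using Cons(6) by auto
    then have "set ys = (set ys \<union> set \<pi>) - set \<pi>" by auto
    also have "\<dots> = {Suc a + length \<pi>..<Suc a + (length \<pi> + length ys)}"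
      unfolding S2 unfolding Sp by auto
    finally show ?thesis .
  qed
  have "ys = [Suc a + length \<pi>..<Suc a + (length \<pi> + length ys)]"
  proof (rule sorted_distinct_set_unique)
    show "sorted ys" using Cons(2) by (simp add: strict_sorted_imp_sorted)
    show "distinct ys" using Cons(6) by simp
  qed (simp_all only: Sy sorted_upt distinct_upt set_upt)
  moreover have "\<pi> = extremal (Suc a) ms"
    using Cons(6) eq1 Sp by (intro Cons.IH) auto
  ultimately show ?case using xa len by (simp add: add_ac)
qed simp

text \<open>
  Every entry \<open>a + sum_list ms + i\<close> with \<open>i \<ge> 1\<close> of the first run exceeds all values
  \<open>{Suc a..<Suc a + sum_list ms}\<close> of the later runs, so the bound of \<open>inversions_first_run\<close> is attained
  at each step.  If another run follows, admissibility provides such an entry, and the first run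
  therefore ends where the next one starts.
\<close>

lemma extremal_properties:
  assumes "admissible ms"
  shows "sorted_runs ms (extremal a ms)"
    and "set (extremal a ms) = {a..<a + sum_list ms}"
    and "distinct (extremal a ms)"
    and "inversions (extremal a ms) + waste ms = sum_list ms choose 2"
proof -
  have len: "length (extremal a ms) = sum_list ms" if "admissible ms" for a ms
    using that by (induction ms arbitrary: a) auto
  have "sorted_runs ms (extremal a ms) \<and> set (extremal a ms) = {a..<a + sum_list ms}
    \<and> distinct (extremal a ms) \<and> inversions (extremal a ms) + waste ms = sum_list ms choose 2"
    using assms
  proof (induction ms arbitrary: a)
    case (Cons m ms)
    let ?n = "sum_list ms" and ?\<pi> = "extremal (Suc a) ms"
    let ?ys = "[a + ?n + 1 ..< a + ?n + m]"
    have adm: "admissible ms" "m \<ge> 1" "ms \<noteq> [] \<longrightarrow> m \<ge> 2" using Cons(2) by auto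
    have IH: "sorted_runs ms ?\<pi>" "set ?\<pi> = {Suc a..<Suc a + ?n}" "distinct ?\<pi>"
      "inversions ?\<pi> + waste ms = ?n choose 2"
      using Cons(1)[OF adm(1)] by blast+
    have srt: "sorted_wrt (<) (a # ?ys)" by auto
    have "?\<pi> = [] \<or> a < hd ?\<pi> \<and> hd ?\<pi> < last (a # ?ys)"
    proof (cases "ms = []")
      case False
      then have "m \<ge> 2" using adm by simp
      moreover have "?\<pi> \<noteq> []" using False by (cases ms) auto
      then have "hd ?\<pi> \<in> {Suc a..<Suc a + ?n}" unfolding IH(2)[symmetric] by simp
      ultimately show ?thesis by auto
    qed simp
    from sorted_runs.Cons[OF IH(1) srt this]
    have "sorted_runs (m # ms) (extremal a (m # ms))" using adm by simp
    moreover have "set (extremal a (m # ms)) = {a..<a + sum_list (m # ms)}"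
      using IH(2) adm by auto
    moreover have "distinct (extremal a (m # ms))"
      using IH(2,3) by auto
    moreover have "inversions (a # ?ys @ ?\<pi>) = length ?ys * length ?\<pi> + inversions ?\<pi>"
      using inversions_first_run(2)[OF srt, of ?\<pi>] IH(2) by auto
    then have "inversions (extremal a (m # ms)) + waste (m # ms) = sum_list (m # ms) choose 2"
      using IH(4) choose_two_add[of m ?n] adm len[OF adm(1), of "Suc a"]
      by (cases m) auto
    ultimately show ?case by blast
  qed (auto intro: sorted_runs.Nil)
  then show "sorted_runs ms (extremal a ms)" "set (extremal a ms) = {a..<a + sum_list ms}"
    "distinct (extremal a ms)" "inversions (extremal a ms) + waste ms = sum_list ms choose 2"
    by blast+
qed

text \<open>
  The entry after the leading \<open>a\<close> is \<open>a + sum_list ms + 1\<close> as soon as the first run has two entries, so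
  it reveals the total length of the later runs.
\<close>

lemma extremal_inject:
  assumes "admissible ms" "admissible ms'" "extremal a ms = extremal a ms'"
  shows "ms = ms'"
  using assms
proof (induction ms arbitrary: a ms')
  case Nil
  then show ?case by (cases ms') auto
next
  case (Cons m ms)
  then obtain m' ms'' where ms': "ms' = m' # ms''" by (cases ms') auto
  have "length (extremal b l) = sum_list l" if "admissible l" for b l
    using that sum_list_sorted_runs[OF extremal_properties(1)[OF that]] by metis
  then have tot: "m + sum_list ms = m' + sum_list ms''"
    using Cons.prems unfolding ms' by (metis sum_list.Cons)
  have adm: "m \<ge> 1" "m' \<ge> 1" "ms \<noteq> [] \<longrightarrow> m \<ge> 2" "ms'' \<noteq> [] \<longrightarrow> m' \<ge> 2"
    "admissible ms" "admissible ms''"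
    using Cons.prems by (auto simp: ms')
  \<comment> \<open>A first run of length \<open>1\<close> is also the last one, so no second entry is needed to recover it.\<close>
  have second: "extremal a (l # ls) ! 1 = a + sum_list ls + 1" if "l \<ge> 2" for l ls
    using that by (simp add: nth_append)
  have "sum_list ms = sum_list ms''"
  proof (cases "m \<ge> 2 \<and> m' \<ge> 2")
    case True
    then show ?thesis using second[of m ms] second[of m' ms''] Cons.prems(3) ms' by simp
  next
    case False
    have "ms = [] \<or> sum_list ms \<ge> 1" "ms'' = [] \<or> sum_list ms'' \<ge> 1"
      using adm(5,6) by (cases ms; cases ms''; simp)+
    then have "ms = [] \<and> ms'' = []" using False adm tot by auto
    then show ?thesis by simp
  qed
  then show ?case
    using Cons.IH[of ms'' "Suc a"] Cons.prems(3) adm tot by (simp add: ms')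
qed

section \<open>Minimising the waste\<close>

text \<open>
  Twice the difference of the two sides is \<open>(m - K) * (m - K - 1)\<close>, a product of two consecutive
  integers; it is never negative and vanishes exactly when one of the factors does.
\<close>

lemma row_bound:
  fixes m K :: nat
  shows "K * m \<le> (m choose 2) + (Suc K choose 2)"
    and "K * m = (m choose 2) + (Suc K choose 2) \<longleftrightarrow> m = K \<or> m = Suc K"
proof -
  have two: "2 * int (l choose 2) = int l * (int l - 1)" for l
  proof -
    have "2 * (l choose 2) = l * (l - 1)" by (cases l) (simp_all add: choose_two)
    then have "int (2 * (l choose 2)) = int (l * (l - 1))" by presburger
    then show ?thesis by (cases l) (simp_all add: algebra_simps)
  qed
  let ?D = "int (m choose 2) + int (Suc K choose 2) - int (K * m)"
  have sq: "2 * ?D = (int m - int K) * (int m - int K - 1)"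
    using two[of m] two[of "Suc K"] by (simp add: algebra_simps)
  have nonneg: "(z::int) * (z - 1) \<ge> 0" for z
    by (cases "z \<ge> 1") (auto simp: mult_nonpos_nonpos)
  have "2 * ?D \<ge> 0" unfolding sq by (rule nonneg)
  then have "int (K * m) \<le> int ((m choose 2) + (Suc K choose 2))" by simp
  then show "K * m \<le> (m choose 2) + (Suc K choose 2)" by (simp only: of_nat_le_iff)
  have "K * m = (m choose 2) + (Suc K choose 2) \<longleftrightarrow>
      int (K * m) = int ((m choose 2) + (Suc K choose 2))" by (simp only: of_nat_eq_iff)
  also have "\<dots> \<longleftrightarrow> 2 * ?D = 0" by auto
  also have "\<dots> \<longleftrightarrow> (int m - int K) * (int m - int K - 1) = 0" unfolding sq ..
  also have "\<dots> \<longleftrightarrow> m = K \<or> m = Suc K" by auto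
  finally show "K * m = (m choose 2) + (Suc K choose 2) \<longleftrightarrow> m = K \<or> m = Suc K" .
qed

text \<open>
  In terms of cells: the sum of \<open>j + t - K\<close> over any set of cells \<open>(j, t)\<close> is least when
  it contains all cells with \<open>j + t < K\<close>, of which \<open>c + 1\<close> have weight \<open>c\<close>, and none with
  \<open>j + t > K\<close>.  The minimum is the negative of \<open>K + 2 choose 3\<close>, the sum of \<open>(c + 1) * (K - c)\<close> over
  \<open>c < K\<close>.  The proof removes the first row, which lowers \<open>K\<close> by \<open>1\<close> for the remaining ones.
\<close>

lemma waste_lower_bound: "K * sum_list ms \<le> waste ms + (K + 2 choose 3)"
proof (induction ms arbitrary: K)
  case (Cons m ms)
  show ?case
  proof (cases K)
    case (Suc L)
    have "K + 2 choose 3 = (L + 2 choose 3) + (Suc K choose 2)"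
      by (simp add: Suc numeral_3_eq_3 numeral_2_eq_2)
    then show ?thesis using Cons[of L] row_bound(1)[of K m] by (simp add: Suc algebra_simps)
  qed simp
qed simp

definition tight :: "nat \<Rightarrow> nat list \<Rightarrow> bool" where
  "tight K ms \<longleftrightarrow> waste ms + (K + 2 choose 3) = K * sum_list ms"

lemma tight_Suc_Nil: "\<not> tight (Suc K) []"
  by (simp add: tight_def)

text \<open>
  The lower bound is a sum of one row bound per run, so equality holds iff it holds in each row.
\<close>

lemma tight_Suc_Cons:
  "tight (Suc K) (m # ms) \<longleftrightarrow> (m = Suc K \<or> m = Suc (Suc K)) \<and> tight K ms"
proof -
  have c: "Suc K + 2 choose 3 = (K + 2 choose 3) + (Suc (Suc K) choose 2)"
    by (simp add: numeral_3_eq_3 numeral_2_eq_2)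
  show ?thesis
    unfolding tight_def
  proof -
    have "Suc K * sum_list (m # ms) = Suc K * m + K * sum_list ms + sum_list ms"
      by (simp add: algebra_simps)
    then have "waste (m # ms) + (Suc K + 2 choose 3) = Suc K * sum_list (m # ms) \<longleftrightarrow>
        Suc K * m = (m choose 2) + (Suc (Suc K) choose 2) \<and>
        waste ms + (K + 2 choose 3) = K * sum_list ms"
      using row_bound(1)[of "Suc K" m] waste_lower_bound[of K ms] c
      unfolding waste.simps by linarith
    then show "waste (m # ms) + (Suc K + 2 choose 3) = Suc K * sum_list (m # ms) \<longleftrightarrow>
        (m = Suc K \<or> m = Suc (Suc K)) \<and> waste ms + (K + 2 choose 3) = K * sum_list ms"
      unfolding row_bound(2) .
  qed
qed

lemma tight_0: "admissible ms \<Longrightarrow> tight 0 ms \<longleftrightarrow> ms = [] \<or> ms = [1]"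
proof (cases ms)
  case (Cons m ls)
  assume adm: "admissible ms"
  have "sum_list ls = 0 \<longleftrightarrow> ls = []" using adm by (cases ls) (auto simp: Cons)
  moreover have "m choose 2 = 0 \<longleftrightarrow> m = 1" using adm by (auto simp: Cons binomial_eq_0_iff)
  ultimately show ?thesis by (auto simp: tight_def Cons)
qed (simp add: tight_def)

text \<open>
  A tight list contains all cells of weight below \<open>K\<close>.
\<close>

lemma tight_imp_sum_list_ge: "tight K ms \<Longrightarrow> Suc K choose 2 \<le> sum_list ms"
proof (induction K arbitrary: ms)
  case (Suc K)
  then obtain m ls where ms: "ms = m # ls" using tight_Suc_Nil by (cases ms) auto
  then have "m \<ge> Suc K" "tight K ls" using Suc.prems by (auto simp: tight_Suc_Cons)
  then show ?case using Suc.IH[of ls] by (simp add: ms numeral_2_eq_2)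
qed (simp add: numeral_2_eq_2)

section \<open>Counting the minimisers\<close>

text \<open>
  Here \<open>K\<close> is \<open>k - 1\<close>, and \<open>d\<close> counts the cells of weight \<open>K\<close>.  The recursion
  below removes the first row, and from \<open>d = K\<close> it can reach the level \<open>K - 1\<close> with the same \<open>d\<close>, where all
  \<open>K\<close> cells of weight \<open>K - 1\<close> are used; so \<open>d\<close> is not bounded by \<open>K\<close>.
\<close>

definition staircases :: "nat \<Rightarrow> nat \<Rightarrow> nat list set" where
  "staircases K d = {ms. admissible ms \<and> tight K ms \<and> sum_list ms = (Suc K choose 2) + d}"

text \<open>
  The recursion starts at \<open>K = 1\<close>.  Here the first row may have length \<open>1\<close>, and admissibility excludes
  \<open>[1, 1]\<close>; at every higher level the first row of a tight list has length at least \<open>2\<close>, so that any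
  admissible list may follow it.
\<close>

lemma staircases_1:
  "staircases (Suc 0) d = (if d = 0 then {[1]} else if d = 1 then {[2]} else if d = 2 then {[2, 1]} else {})"
proof -
  have two: "Suc (Suc 0) choose 2 = 1" by (simp add: numeral_2_eq_2)
  have "ms \<in> staircases (Suc 0) d \<longleftrightarrow>
    d = 0 \<and> ms = [1] \<or> d = 1 \<and> ms = [2] \<or> d = 2 \<and> ms = [2, 1]" for ms
  proof (cases ms)
    case Nil
    then show ?thesis by (simp add: staircases_def tight_Suc_Nil)
  next
    case (Cons m ls)
    then show ?thesis
      using tight_0[of ls] two
      by (auto simp: staircases_def tight_Suc_Cons)
  qed
  then show ?thesis by (intro set_eqI) simp
qed

text \<open>
  The first row either stops before its cell of weight \<open>Suc K\<close> or contains it.  For \<open>d = 0\<close> the second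
  option would leave fewer cells than \<open>tight_imp_sum_list_ge\<close> demands.
\<close>

lemma staircases_Suc:
  assumes "K \<ge> 1"
  shows "staircases (Suc K) d = (#) (Suc K) ` staircases K d \<union>
    (if d = 0 then {} else (#) (Suc (Suc K)) ` staircases K (d - 1))" (is "_ = ?R")
proof (rule set_eqI)
  fix ms
  show "ms \<in> staircases (Suc K) d \<longleftrightarrow> ms \<in> ?R"
  proof (cases ms)
    case Nil
    then show ?thesis by (auto simp: staircases_def tight_Suc_Nil)
  next
    case (Cons m ls)
    have c: "Suc (Suc K) choose 2 = (Suc K choose 2) + Suc K" by (simp add: numeral_2_eq_2)
    show ?thesis
      using assms tight_imp_sum_list_ge[of K ls] unfolding Cons
      by (auto simp: staircases_def tight_Suc_Cons c)
  qed
qed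

lemma finite_staircases: "K \<ge> 1 \<Longrightarrow> finite (staircases K d)"
  by (induction K arbitrary: d rule: dec_induct) (simp_all add: staircases_1 staircases_Suc)

text \<open>
  Both binomial coefficients satisfy the recursion of \<open>staircases_Suc\<close>, by Pascal's rule.
\<close>

lemma card_staircases:
  "card (staircases (Suc L) d) = (Suc L choose d) + (if d \<ge> 2 then L choose (d - 2) else 0)"
proof (induction L arbitrary: d)
  case 0
  have "d = 0 \<or> d = 1 \<or> d = 2 \<or> d \<ge> 3" by auto
  then show ?case using staircases_1[of d] by (auto simp: binomial_eq_0)
next
  case (Suc L)
  let ?S = "staircases (Suc L)"
  have rec: "staircases (Suc (Suc L)) d = (#) (Suc (Suc L)) ` ?S d \<union>
    (if d = 0 then {} else (#) (Suc (Suc (Suc L))) ` ?S (d - 1))"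
    using staircases_Suc[of "Suc L" d] by simp
  have fin: "finite (?S e)" for e by (rule finite_staircases) simp
  have disj: "(#) (Suc (Suc L)) ` A \<inter> (#) (Suc (Suc (Suc L))) ` B = {}" for A B by auto
  have crd: "card ((#) m ` A) = card A" for m and A :: "nat list set"
    by (simp add: card_image)
  have "card (staircases (Suc (Suc L)) d) = card (?S d) + (if d = 0 then 0 else card (?S (d - 1)))"
    unfolding rec using fin disj by (simp add: crd card_Un_disjoint)
  also have "\<dots> = (Suc (Suc L) choose d) + (if d \<ge> 2 then Suc L choose (d - 2) else 0)"
  proof (cases "d \<ge> 2")
    case True
    then obtain e where "d = Suc (Suc e)" by (metis add_2_eq_Suc le_Suc_ex)
    then show ?thesis by (cases e) (simp_all add: Suc.IH)
  next
    case False
    then have "d = 0 \<or> d = 1" by auto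
    then show ?thesis by (auto simp: Suc.IH)
  qed
  finally show ?case .
qed

section \<open>The maximum and the number of maximisers\<close>

lemma choose_two_choose_two: "(k choose 2) choose 2 = 3 * (k choose 3) + 3 * (k choose 4)"
proof (induction k)
  case (Suc k)
  have "Suc k * (k choose 2) = 3 * (Suc k choose 3)"
    using Suc_times_binomial_eq[of k 2] by (simp add: numeral_3_eq_3 numeral_2_eq_2)
  moreover have "Suc k choose 2 = k + (k choose 2)" "Suc k choose 3 = (k choose 2) + (k choose 3)"
    "Suc k choose 4 = (k choose 3) + (k choose 4)"
    by (simp_all add: eval_nat_numeral)
  ultimately show ?case using Suc choose_two_add[of k "k choose 2"] by simp
qed (simp add: binomial_eq_0)

text \<open>
  Equates \<open>(n choose 2)\<close> minus the least waste with the closed form of the maximum, for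
  \<open>n = (Suc K choose 2) + d\<close>; the subtracted terms have been moved to the other side.
\<close>

lemma max_value_identity:
  "((Suc K choose 2) + d choose 2) + (K + 2 choose 3) =
     (Suc K choose 3) + 3 * (Suc K choose 4) + d * (K choose 2) + (d choose 2)
       + K * ((Suc K choose 2) + d)"
proof -
  let ?X = "Suc K choose 2"
  have "(K + 2) * ?X = 3 * (K + 2 choose 3)"
    using Suc_times_binomial_eq[of "Suc K" 2] by (simp add: numeral_3_eq_3 numeral_2_eq_2)
  moreover have X: "K + 2 choose 3 = ?X + (Suc K choose 3)"
    by (simp add: eval_nat_numeral)
  ultimately have KX: "K * ?X = ?X + 3 * (Suc K choose 3)" by (simp add: algebra_simps)
  have "?X = K + (K choose 2)" by (simp add: eval_nat_numeral)
  then have dX: "?X * d = d * K + d * (K choose 2)" by (simp add: algebra_simps)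
  show ?thesis
    using choose_two_add[of ?X d] choose_two_choose_two[of "Suc K"] X KX dX
    by (simp add: add_mult_distrib2 mult.commute)
qed

lemma run_sorted_perms_iff:
  assumes "n \<ge> 1"
  shows "\<pi> \<in> run_sorted_perms n \<longleftrightarrow> distinct \<pi> \<and> set \<pi> = {1..<1 + n} \<and> (\<exists>ms. sorted_runs ms \<pi>)"
proof -
  have I: "{1..n} = {1..<1 + n}" by auto
  have "hd \<pi> = 1" if "set \<pi> = {1..<1 + n}" "sorted_runs ms \<pi>" for ms
  proof -
    have "1 \<in> set \<pi>" using that(1) assms by simp
    then have "hd \<pi> \<le> 1" "hd \<pi> \<in> set \<pi>" using sorted_runs_hd_le[OF that(2)] by (auto intro!: hd_in_set)
    then show ?thesis using that(1) by auto
  qed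
  then show ?thesis
    using assms
    by (auto simp: run_sorted_perms_def permutations_of_set_def run_sorted_iff I
        starts_increase_iff_sorted_runs)
qed

lemma finite_run_sorted_perms: "finite (run_sorted_perms n)"
  by (simp add: run_sorted_perms_def)

text \<open>
  The coefficient of \<open>q\<^sup>i\<close> counts the permutations with \<open>i\<close> inversions, so no cancellation can occur
  in the leading term.
\<close>

lemma degree_inv_poly:
  assumes "run_sorted_perms n \<noteq> {}"
  shows "degree (inv_poly n) = max_inv n"
proof -
  let ?R = "run_sorted_perms n"
  have coeff: "coeff (inv_poly n) i = int (card {\<pi> \<in> ?R. inversions \<pi> = i})" for i
  proof -
    have "coeff (inv_poly n) i = (\<Sum>\<pi>\<in>?R. if inversions \<pi> = i then 1 else 0)"
      unfolding inv_poly_def coeff_sum by (intro sum.cong) auto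
    also have "\<dots> = int (card {\<pi> \<in> ?R. inversions \<pi> = i})"
      using sum.inter_filter[OF finite_run_sorted_perms, of "\<lambda>_. 1::int" n "\<lambda>\<pi>. inversions \<pi> = i"]
      by simp
    finally show ?thesis .
  qed
  have fin: "finite (inversions ` ?R)" using finite_run_sorted_perms by simp
  have le: "inversions \<pi> \<le> max_inv n" if "\<pi> \<in> ?R" for \<pi>
    unfolding max_inv_def using fin that by (intro Max_ge) auto
  have "max_inv n \<in> inversions ` ?R"
    unfolding max_inv_def using fin assms by (intro Max_in) auto
  then have "card {\<pi> \<in> ?R. inversions \<pi> = max_inv n} \<noteq> 0"
    using finite_run_sorted_perms by auto
  then have "max_inv n \<le> degree (inv_poly n)" by (intro le_degree) (simp add: coeff)
  moreover have "coeff (inv_poly n) i = 0" if "i > max_inv n" for i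
  proof -
    have "{\<pi> \<in> ?R. inversions \<pi> = i} = {}" using le that by fastforce
    then show ?thesis by (simp only: coeff) simp
  qed
  then have "degree (inv_poly n) \<le> max_inv n" by (intro degree_le) auto
  ultimately show ?thesis by simp
qed

theorem theorem3p1:
  fixes n k d :: nat
  assumes "k \<ge> 2" and "d \<le> k - 1" and "n = (k choose 2) + d"
  shows "max_inv n = degree (inv_poly n)
    \<and> max_inv n = (k choose 3) + 3 * (k choose 4) + d * ((k - 1) choose 2) + (d choose 2)
    \<and> card {\<pi> \<in> run_sorted_perms n. inversions \<pi> = max_inv n}
        = ((k - 1) choose d) + (if d \<ge> 2 then (k - 2) choose (d - 2) else 0)"
proof -
  obtain L where k: "k = Suc (Suc L)" using assms(1) by (metis add_2_eq_Suc le_Suc_ex)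
  let ?K = "Suc L"
  let ?u = "(k choose 3) + 3 * (k choose 4) + d * ((k - 1) choose 2) + (d choose 2)"
  have n: "n = (Suc ?K choose 2) + d" using assms(3) k by simp
  then have n1: "n \<ge> 1" by (simp add: numeral_2_eq_2)
  have u: "(n choose 2) + (?K + 2 choose 3) = ?u + ?K * n"
    using max_value_identity[of ?K d] unfolding n k by simp
  have le: "inversions \<pi> \<le> ?u" if \<pi>: "\<pi> \<in> run_sorted_perms n" for \<pi>
  proof -
    obtain ms where ms: "sorted_runs ms \<pi>" "distinct \<pi>" "set \<pi> = {1..<1 + n}"
      using \<pi> run_sorted_perms_iff[OF n1] by blast
    then have "length \<pi> = n" using distinct_card[of \<pi>] by simp
    then show ?thesis
      using inversions_plus_waste_le[OF ms(1)] sum_list_sorted_runs[OF ms(1)]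
        waste_lower_bound[of ?K ms] u by simp
  qed
  have eq: "{\<pi> \<in> run_sorted_perms n. inversions \<pi> = ?u} = extremal 1 ` staircases ?K d"
  proof (intro equalityI subsetI)
    fix \<pi> assume "\<pi> \<in> {\<pi> \<in> run_sorted_perms n. inversions \<pi> = ?u}"
    then obtain ms where ms: "sorted_runs ms \<pi>" "distinct \<pi>" "set \<pi> = {1..<1 + n}"
      and inv: "inversions \<pi> = ?u"
      using run_sorted_perms_iff[OF n1] by blast
    then have len: "length \<pi> = n" "sum_list ms = n"
      using distinct_card[of \<pi>] sum_list_sorted_runs[OF ms(1)] by simp_all
    have "inversions \<pi> + waste ms \<le> n choose 2" "?K * n \<le> waste ms + (?K + 2 choose 3)"
      using inversions_plus_waste_le[OF ms(1)] waste_lower_bound[of ?K ms] by (simp_all only: len)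
    then have *: "inversions \<pi> + waste ms = n choose 2" "waste ms + (?K + 2 choose 3) = ?K * n"
      using u inv by linarith+
    have "\<pi> = extremal 1 ms"
      using inversions_plus_waste_eq_imp_extremal[OF ms(1) _ ms(2), of 1] ms(3) len *(1) by simp
    moreover have "ms \<in> staircases ?K d"
      using *(2) len n sorted_runs_admissible[OF ms(1)] by (simp add: staircases_def tight_def)
    ultimately show "\<pi> \<in> extremal 1 ` staircases ?K d" by blast
  next
    fix \<pi> assume "\<pi> \<in> extremal 1 ` staircases ?K d"
    then obtain ms where ms: "\<pi> = extremal 1 ms" "admissible ms" "tight ?K ms" "sum_list ms = n"
      by (auto simp: staircases_def n)
    note ex = extremal_properties[OF ms(2), of 1, folded ms(1), unfolded ms(4)]
    have "\<pi> \<in> run_sorted_perms n"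
      using ex run_sorted_perms_iff[OF n1] by blast
    moreover have "inversions \<pi> = ?u"
      using ex(4) ms(3) u unfolding tight_def ms(4) by linarith
    ultimately show "\<pi> \<in> {\<pi> \<in> run_sorted_perms n. inversions \<pi> = ?u}" by blast
  qed
  have "inj_on (extremal 1) (staircases ?K d)"
    by (intro inj_onI) (auto simp: staircases_def intro: extremal_inject)
  then have "card {\<pi> \<in> run_sorted_perms n. inversions \<pi> = ?u} = card (staircases ?K d)"
    unfolding eq by (rule card_image)
  then have crd: "card {\<pi> \<in> run_sorted_perms n. inversions \<pi> = ?u}
      = ((k - 1) choose d) + (if d \<ge> 2 then (k - 2) choose (d - 2) else 0)"
    using card_staircases[of L d] by (simp add: k)
  moreover have "(k - 1) choose d > 0" using assms(2) by simp
  ultimately have "card {\<pi> \<in> run_sorted_perms n. inversions \<pi> = ?u} \<noteq> 0" by linarith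
  then have "{\<pi> \<in> run_sorted_perms n. inversions \<pi> = ?u} \<noteq> {}" by (metis card.empty)
  then obtain \<pi> where \<pi>: "\<pi> \<in> run_sorted_perms n" "inversions \<pi> = ?u" by blast
  have max: "max_inv n = ?u"
    unfolding max_inv_def 
  proof (rule Max_eqI)
    show "?u \<in> inversions ` run_sorted_perms n" using \<pi> by (metis imageI)
  qed (use le finite_run_sorted_perms in auto)
  show ?thesis
  proof (intro conjI)
    show "max_inv n = degree (inv_poly n)" using degree_inv_poly[of n] \<pi>(1) by (metis empty_iff)
  qed (use crd in \<open>simp_all only: max\<close>)
qed

end
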